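(* Let $M_Q = [q_{ij}]_{i,j=1}^{n_p}$, $q_{ij} = \int_\Omega \phi_i\,\phi_j$, be the pressure mass matrix for the enriched Taylor--Hood pressure space $Q_h^{\star} = \{q = q_k + q_0 : q_k \in Q_h^{TH},\ q_0 \in Q_h^0\}$, specified by the frame $Q_h^{\star} = \mathrm{span}\{\phi_1,\dotsc,\phi_{n_k},\phi_{n_k+1},\dotsc,\phi_{n_p}\}$, where $\{\phi_i\}_{i=1}^{n_k}$ is the Lagrange basis of $Q_h^{TH}$ and $\{\phi_i\}_{i=n_k+1}^{n_p}$ is the Lagrange basis of $Q_h^0$. Then $\mathrm{null}(M_Q) = \mathrm{span}\{\boldsymbol{k}\}$, where $$\boldsymbol{k} = \begin{bmatrix} \boldsymbol{1}_{n_k} \\ -\boldsymbol{1}_{n_0} \end{bmatrix} \in \mathbb{R}^{n_p}, \qquad n_0 = n_p - n_k .$$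
   Context: $\Omega \subset \mathbb{R}^d$, $d \in \{2,3\}$, is a polygonal or polyhedral domain (in particular bounded, open and connected). It is decomposed by a mesh belonging to a shape-regular family of simplicial, quadrilateral (if $d=2$) or hexahedral (if $d=3$) decompositions of $\Omega$; any two elements have at most a common face, edge, or vertex. $Q_h^{TH}$ is the usual Taylor--Hood pressure space of degree $k \ge 1$: the space of functions, continuous on $\overline{\Omega}$, that restrict on each element to polynomials of total degree at most $k$ ($\mathbb{P}_k$, on simplicial meshes, in which case it is additionally assumed that $k \ge d-1$) or to (mapped) tensor-product polynomials of degree at most $k$ in each variable ($\mathbb{Q}_k$, on quadrilateral or hexahedral meshes). The corresponding Taylor--Hood pair is $(\mathbb{P}_{k+1})^d\times\mathbb{P}_k$ or $(\mathbb{Q}_{k+1})^d\times\mathbb{Q}_k$. No zero-mean constraint is imposed on the span of the pressure basis functions, so the constant functions belong to $Q_h^{TH}$. $Q_h^0$ is the space of discontinuous pressures that are constant on each element. The Lagrange basis of $Q_h^{TH}$ is the standard nodal basis (each basis function equals $1$ at one node and $0$ at all other nodes). The Lagrange basis of $Q_h^0$ consists of the indicator functions of the individual elements, so $n_0 = n_p-n_k$ is the number of elements. $\boldsymbol{1}_m$ denotes the vector of all ones in $\mathbb{R}^m$, and $\mathrm{null}(\cdot)$ denotes the nullspace of a real matrix. *)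

theory Defs
  imports "HOL-Analysis.Analysis" "Jordan_Normal_Form.Matrix_Kernel"
begin

no_notation vec_index (infixl "$" 100)

section \<open>Polygonal and polyhedral domains\<close>

text \<open>The boundary consists of finitely many flat facets of dimension \<open>d - 1\<close>. A polytope is convex
  in the library; a non-convex facet is cut into several convex ones.\<close>

definition polyhedral_domain :: "(real^'d) set \<Rightarrow> bool" where
  "polyhedral_domain \<Omega> \<longleftrightarrow>
     \<Omega> \<noteq> {} \<and> open \<Omega> \<and> connected \<Omega> \<and> bounded \<Omega> \<and>
     (\<exists>\<P>. finite \<P> \<and> (\<forall>P\<in>\<P>. polytope P \<and> aff_dim P = int CARD('d) - 1) \<and> frontier \<Omega> = \<Union>\<P>)"


section \<open>Polynomials and reference cells\<close>

definition polys :: "('d::finite \<Rightarrow> nat) set \<Rightarrow> (real^'d \<Rightarrow> real) set" where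
  "polys A = {\<lambda>x. \<Sum>\<alpha>\<in>A. c \<alpha> * (\<Prod>i\<in>UNIV. (x $ i) ^ \<alpha> i) | c. True}"

definition P_polys :: "nat \<Rightarrow> (real^'d \<Rightarrow> real) set" where
  "P_polys k = polys {\<alpha>. (\<Sum>i\<in>UNIV. \<alpha> i) \<le> k}"

definition Q_polys :: "nat \<Rightarrow> (real^'d \<Rightarrow> real) set" where
  "Q_polys k = polys {\<alpha>. \<forall>i. \<alpha> i \<le> k}"

text \<open>A tensor-product cell is a quadrilateral if \<open>d = 2\<close> and a hexahedron if \<open>d = 3\<close>.\<close>

datatype cell_type = Simplicial | Tensor

fun ref_cell :: "cell_type \<Rightarrow> (real^'d) set" where
  "ref_cell Simplicial = convex hull (insert 0 Basis)"
| "ref_cell Tensor = cbox 0 1"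

fun ref_polys :: "cell_type \<Rightarrow> nat \<Rightarrow> (real^'d \<Rightarrow> real) set" where
  "ref_polys Simplicial k = P_polys k"
| "ref_polys Tensor k = Q_polys k"

text \<open>On the simplex this is the principal lattice: the remaining barycentric coordinate
  \<open>1 - (\<Sum>i\<in>UNIV. x $ i)\<close> is then a multiple of \<open>1/k\<close> as well.\<close>

definition ref_nodes :: "cell_type \<Rightarrow> nat \<Rightarrow> (real^'d) set" where
  "ref_nodes t k = {x \<in> ref_cell t. \<forall>i. \<exists>m::nat. x $ i = real m / real k}"


section \<open>Meshes\<close>

text \<open>An element is represented by its map \<open>F\<close> from the reference cell; the element itself is
  \<open>cell t F\<close>. The map is affine on simplices and \<open>d\<close>-linear on quadrilaterals and hexahedra.\<close>

definition element_map :: "cell_type \<Rightarrow> (real^'d \<Rightarrow> real^'d) \<Rightarrow> bool" where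
  "element_map t F \<longleftrightarrow> (\<forall>i. (\<lambda>x. F x $ i) \<in> ref_polys t 1) \<and> inj_on F (ref_cell t)"

definition cell :: "cell_type \<Rightarrow> (real^'d \<Rightarrow> real^'d) \<Rightarrow> (real^'d) set" where
  "cell t F = F ` ref_cell t"

text \<open>Proper faces of the reference cell are its facets, edges and vertices, and the empty set.\<close>

definition proper_cell_faces :: "cell_type \<Rightarrow> (real^'d \<Rightarrow> real^'d) \<Rightarrow> (real^'d) set set" where
  "proper_cell_faces t F = {F ` f | f. f face_of ref_cell t \<and> f \<noteq> ref_cell t}"

definition is_mesh :: "cell_type \<Rightarrow> (real^'d) set \<Rightarrow> (real^'d \<Rightarrow> real^'d) set \<Rightarrow> bool" where
  "is_mesh t \<Omega> \<T> \<longleftrightarrow>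
     finite \<T> \<and> (\<forall>F\<in>\<T>. element_map t F) \<and> (\<Union>F\<in>\<T>. cell t F) = closure \<Omega> \<and>
     (\<forall>F\<in>\<T>. \<forall>G\<in>\<T>. F \<noteq> G \<longrightarrow>
        cell t F \<inter> cell t G \<in> proper_cell_faces t F \<inter> proper_cell_faces t G)"

text \<open>For simplices, the diameter is bounded by a multiple of the inradius. For quadrilaterals and
  hexahedra, the Jacobian and its inverse scale like \<open>h\<close> and \<open>1/h\<close>, \<open>h\<close> being the diameter.\<close>

fun shape_regular_cell :: "cell_type \<Rightarrow> real \<Rightarrow> (real^'d \<Rightarrow> real^'d) \<Rightarrow> bool" where
  "shape_regular_cell Simplicial \<sigma> F \<longleftrightarrow>
     (\<exists>z r. 0 < r \<and> cball z r \<subseteq> cell Simplicial F \<and> diameter (cell Simplicial F) \<le> \<sigma> * r)"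
| "shape_regular_cell Tensor \<sigma> F \<longleftrightarrow>
     (let h = diameter (cell Tensor F) in
      \<forall>x\<in>ref_cell Tensor. \<forall>v. norm (frechet_derivative F (at x) v) \<le> \<sigma> * h * norm v \<and>
         h * norm v \<le> \<sigma> * norm (frechet_derivative F (at x) v))"

definition shape_regular_family ::
    "cell_type \<Rightarrow> (real^'d) set \<Rightarrow> (real^'d \<Rightarrow> real^'d) set set \<Rightarrow> bool" where
  "shape_regular_family t \<Omega> \<M> \<longleftrightarrow>
     (\<forall>\<T>\<in>\<M>. is_mesh t \<Omega> \<T>) \<and> (\<exists>\<sigma>>0. \<forall>\<T>\<in>\<M>. \<forall>F\<in>\<T>. shape_regular_cell t \<sigma> F)"


section \<open>Pressure spaces\<close>

text \<open>Polynomials of total degree at most \<open>k\<close> on a simplex; mapped tensor-product polynomials on a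
  quadrilateral or hexahedron.\<close>

fun local_space :: "cell_type \<Rightarrow> nat \<Rightarrow> (real^'d \<Rightarrow> real^'d) \<Rightarrow> (real^'d \<Rightarrow> real) set" where
  "local_space Simplicial k F = {q. \<exists>p\<in>P_polys k. \<forall>x\<in>cell Simplicial F. q x = p x}"
| "local_space Tensor k F = {q. \<exists>p\<in>Q_polys k. \<forall>y\<in>ref_cell Tensor. q (F y) = p y}"

text \<open>Functions on \<open>closure \<Omega>\<close> are extended by zero, so that equality in the space is equality of
  HOL functions.\<close>

definition taylor_hood ::
    "cell_type \<Rightarrow> (real^'d) set \<Rightarrow> (real^'d \<Rightarrow> real^'d) set \<Rightarrow> nat \<Rightarrow> (real^'d \<Rightarrow> real) set" where
  "taylor_hood t \<Omega> \<T> k =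
     {q. continuous_on (closure \<Omega>) q \<and> (\<forall>F\<in>\<T>. q \<in> local_space t k F) \<and> (\<forall>x. x \<notin> closure \<Omega> \<longrightarrow> q x = 0)}"

text \<open>Elements share boundary points, where a piecewise constant function has no well-defined value.
  The representative used here vanishes on that null set (and outside \<open>\<Omega>\<close>): it is constant on the
  interior of each element and zero elsewhere.\<close>

definition piecewise_constant ::
    "cell_type \<Rightarrow> (real^'d \<Rightarrow> real^'d) set \<Rightarrow> (real^'d \<Rightarrow> real) set" where
  "piecewise_constant t \<T> =
     {q. (\<forall>F\<in>\<T>. \<exists>c. \<forall>x\<in>interior (cell t F). q x = c) \<and>
         (\<forall>x. x \<notin> (\<Union>F\<in>\<T>. interior (cell t F)) \<longrightarrow> q x = 0)}"

definition enriched_taylor_hood ::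
    "cell_type \<Rightarrow> (real^'d) set \<Rightarrow> (real^'d \<Rightarrow> real^'d) set \<Rightarrow> nat \<Rightarrow> (real^'d \<Rightarrow> real) set" where
  "enriched_taylor_hood t \<Omega> \<T> k =
     {\<lambda>x. qk x + q0 x | qk q0. qk \<in> taylor_hood t \<Omega> \<T> k \<and> q0 \<in> piecewise_constant t \<T>}"


section \<open>Frames, Lagrange bases and the mass matrix\<close>

definition fun_span :: "nat \<Rightarrow> (nat \<Rightarrow> 'a \<Rightarrow> real) \<Rightarrow> ('a \<Rightarrow> real) set" where
  "fun_span n \<phi> = {\<lambda>x. \<Sum>i<n. c i * \<phi> i x | c. True}"

definition mesh_nodes :: "cell_type \<Rightarrow> (real^'d \<Rightarrow> real^'d) set \<Rightarrow> nat \<Rightarrow> (real^'d) set" where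
  "mesh_nodes t \<T> k = (\<Union>F\<in>\<T>. F ` ref_nodes t k)"

text \<open>Linear independence of the \<open>\<phi> i\<close> follows from the nodal property.\<close>

definition nodal_basis ::
    "('a \<Rightarrow> real) set \<Rightarrow> 'a set \<Rightarrow> nat \<Rightarrow> (nat \<Rightarrow> 'a \<Rightarrow> real) \<Rightarrow> bool" where
  "nodal_basis V N n \<phi> \<longleftrightarrow> fun_span n \<phi> = V \<and>
     (\<exists>a. bij_betw a {..<n} N \<and> (\<forall>i<n. \<forall>j<n. \<phi> i (a j) = (if i = j then 1 else 0)))"

text \<open>The indicator functions of the elements, in the representation of
  \<^const>\<open>piecewise_constant\<close>.\<close>

definition element_indicator_basis ::
    "cell_type \<Rightarrow> (real^'d \<Rightarrow> real^'d) set \<Rightarrow> nat \<Rightarrow> (nat \<Rightarrow> real^'d \<Rightarrow> real) \<Rightarrow> bool" where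
  "element_indicator_basis t \<T> n \<psi> \<longleftrightarrow>
     (\<exists>F. bij_betw F {..<n} \<T> \<and> (\<forall>i<n. \<psi> i = indicator (interior (cell t (F i)))))"

definition mass_matrix :: "(real^'d) set \<Rightarrow> nat \<Rightarrow> (nat \<Rightarrow> real^'d \<Rightarrow> real) \<Rightarrow> real mat" where
  "mass_matrix \<Omega> n \<phi> = Matrix.mat n n (\<lambda>(i, j). LINT x:\<Omega>|lborel. \<phi> i x * \<phi> j x)"

definition ones_vec :: "nat \<Rightarrow> real Matrix.vec" where
  "ones_vec m = Matrix.vec m (\<lambda>_. 1)"

abbreviation vec_span :: "nat \<Rightarrow> real Matrix.vec set \<Rightarrow> real Matrix.vec set" where
  "vec_span n \<equiv> LinearCombinations.module.span class_ring (module_vec TYPE(real) n)"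

end

theory Submission
  imports Defs
begin

text \<open>The mass matrix is the Gram matrix of the frame in \<open>L\<^sup>2(\<Omega>)\<close>, so \<open>v\<close> is in its nullspace
  exactly if the function \<open>\<Sum>i. v i * \<phi> i\<close> vanishes almost everywhere in \<open>\<Omega>\<close>
  (\<open>mat_kernel_mass_matrix\<close>). The nullspace thus records the overlap of the continuous and
  the discontinuous pressures, and the claim is that this overlap consists of the constants.

  Let \<open>q\<close> be the Taylor--Hood part of a vanishing combination. Almost everywhere, \<open>q\<close> is minus
  the elementwise constant part, hence \<open>q\<close> takes only finitely many values on a subset of full
  measure. Such a subset is dense in \<open>closure \<Omega>\<close>, so by continuity \<open>q\<close> takes only these values on
  all of \<open>closure \<Omega>\<close>; a continuous function with finite range on a connected set is a constant
  \<open>c\<close> (\<open>continuous_ae_piecewise_constant_imp_constant\<close>). Connectedness of \<open>\<Omega>\<close> thus takes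
  the place of an argument along chains of adjacent elements. Evaluating \<open>q\<close> at the nodes shows that
  every nodal coefficient is \<open>c\<close>. Every element coefficient is \<open>-c\<close>, as each element interior is a
  nonempty open subset of \<open>closure \<Omega>\<close> and therefore meets the set of full measure.

  Conversely, the nodal basis sums to \<open>1\<close> on \<open>closure \<Omega>\<close> (\<open>taylor_hood_partition_of_unity\<close>), as
  constants are Taylor--Hood functions, and the element indicators sum to \<open>1\<close> off the element
  boundaries.

  What is needed of the geometry is that elements have nonempty interior, negligible boundary,
  and pairwise disjoint interiors. All of this is inherited from the convex reference cell: the
  element maps are injective and polynomial, so they map its interior to an open set by invariance
  of domain, and its null boundary to a null set by differentiability. Distinct elements meet in the image
  of a proper face, which lies in that boundary, so their interiors are disjoint.\<close>

section \<open>Kernels of Gram matrices\<close>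

lemma vec_span_singleton:
  assumes "v \<in> carrier_vec n"
  shows "vec_span n {v} = {c \<cdot>\<^sub>v v | c. True}"
proof -
  interpret vec_space "TYPE(real)" n .
  have fin: "finite {v}" "{v} \<subseteq> carrier_vec n" using assms by auto
  have lc: "lincomb a {v} = a v \<cdot>\<^sub>v v" for a
    using assms by (intro eq_vecI) (auto simp: lincomb_index lincomb_dim)
  have "vec_span n {v} = {lincomb a {v} | a. a \<in> ({v} \<rightarrow> carrier class_ring)}"
    using finite_span[of "{v}"] fin by auto
  also have "\<dots> = {c \<cdot>\<^sub>v v | c. True}"
  proof -
    have "\<exists>a. c \<cdot>\<^sub>v v = a v \<cdot>\<^sub>v v" for c by (rule exI[of _ "\<lambda>_. c"]) simp
    then show ?thesis by (auto simp: lc class_ring_simps)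
  qed
  finally show ?thesis .
qed

lemma mass_matrix_mult_vec:
  assumes v: "v \<in> carrier_vec n"
    and int: "\<And>i j. i < n \<Longrightarrow> j < n \<Longrightarrow> set_integrable lborel \<Omega> (\<lambda>x. \<phi> i x * \<phi> j x)"
    and i: "i < n"
  shows "vec_index (mass_matrix \<Omega> n \<phi> *\<^sub>v v) i =
    (LINT x:\<Omega>|lborel. \<phi> i x * (\<Sum>j<n. vec_index v j * \<phi> j x))"
proof -
  have "vec_index (mass_matrix \<Omega> n \<phi> *\<^sub>v v) i =
      (\<Sum>j<n. (LINT x:\<Omega>|lborel. \<phi> i x * \<phi> j x) * vec_index v j)"
    using v i by (simp add: mass_matrix_def scalar_prod_def lessThan_atLeast0)
  also have "\<dots> = (\<Sum>j<n. LINT x:\<Omega>|lborel. \<phi> i x * (vec_index v j * \<phi> j x))"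
    by (rule sum.cong) (auto simp: set_integral_mult_left[symmetric] mult_ac)
  also have "\<dots> = (LINT x:\<Omega>|lborel. (\<Sum>j<n. \<phi> i x * (vec_index v j * \<phi> j x)))"
    unfolding set_lebesgue_integral_def scaleR_sum_right
  proof (rule Bochner_Integration.integral_sum[symmetric])
    fix j assume "j \<in> {..<n}"
    then have "set_integrable lborel \<Omega> (\<lambda>x. vec_index v j * (\<phi> i x * \<phi> j x))"
      using int i by (intro set_integrable_mult_right) auto
    then show "integrable lborel (\<lambda>x. indicat_real \<Omega> x *\<^sub>R (\<phi> i x * (vec_index v j * \<phi> j x)))"
      by (simp add: set_integrable_def mult_ac)
  qed
  finally show ?thesis by (simp add: sum_distrib_left)
qed

text \<open>If \<open>M v = 0\<close>, then \<open>v\<^sup>T M v\<close> is the integral of the square of \<open>\<Sum>i. v i * \<phi> i\<close> and vanishes.\<close>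

lemma mat_kernel_mass_matrix:
  assumes int: "\<And>i j. i < n \<Longrightarrow> j < n \<Longrightarrow> set_integrable lborel \<Omega> (\<lambda>x. \<phi> i x * \<phi> j x)"
  shows "mat_kernel (mass_matrix \<Omega> n \<phi>) =
    {v \<in> carrier_vec n. AE x\<in>\<Omega> in lborel. (\<Sum>i<n. vec_index v i * \<phi> i x) = 0}"
proof -
  have carr: "mass_matrix \<Omega> n \<phi> \<in> carrier_mat n n" by (simp add: mass_matrix_def)
  have "mass_matrix \<Omega> n \<phi> *\<^sub>v v = 0\<^sub>v n \<longleftrightarrow>
      (AE x\<in>\<Omega> in lborel. (\<Sum>i<n. vec_index v i * \<phi> i x) = 0)"
    if v: "v \<in> carrier_vec n" for v
  proof
    let ?u = "\<lambda>x. \<Sum>i<n. vec_index v i * \<phi> i x"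
    have int_row: "integrable lborel (\<lambda>x. indicator \<Omega> x *\<^sub>R (\<phi> i x * ?u x))" if "i < n" for i
    proof -
      have "integrable lborel (\<lambda>x. \<Sum>j<n. vec_index v j * (indicat_real \<Omega> x * (\<phi> i x * \<phi> j x)))"
        using int that by (intro Bochner_Integration.integrable_sum integrable_mult_right)
          (auto simp: set_integrable_def)
      then show ?thesis by (simp add: sum_distrib_left mult_ac)
    qed
    have square: "indicat_real \<Omega> x *\<^sub>R (?u x * ?u x) =
        (\<Sum>i<n. vec_index v i * (indicator \<Omega> x *\<^sub>R (\<phi> i x * ?u x)))" for x
      by (simp add: sum_distrib_left sum_distrib_right mult_ac)
    {
      assume "mass_matrix \<Omega> n \<phi> *\<^sub>v v = 0\<^sub>v n"
      then have row: "(LINT x:\<Omega>|lborel. \<phi> i x * ?u x) = 0" if "i < n" for i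
        using mass_matrix_mult_vec[where \<phi>=\<phi>, OF v int that] that by simp
      have isq: "integrable lborel (\<lambda>x. indicat_real \<Omega> x *\<^sub>R (?u x * ?u x))"
        unfolding square using int_row
        by (intro Bochner_Integration.integrable_sum integrable_mult_right) auto
      have "(LINT x|lborel. indicat_real \<Omega> x *\<^sub>R (?u x * ?u x)) =
          (\<Sum>i<n. vec_index v i * (LINT x|lborel. indicator \<Omega> x *\<^sub>R (\<phi> i x * ?u x)))"
        unfolding square using int_row
        by (subst Bochner_Integration.integral_sum) (auto intro!: integrable_mult_right)
      also have "\<dots> = 0"
        using row by (auto simp: set_lebesgue_integral_def intro!: sum.neutral)
      finally have "AE x in lborel. indicat_real \<Omega> x *\<^sub>R (?u x * ?u x) = 0"
        by (subst (asm) integral_nonneg_eq_0_iff_AE[OF isq]) auto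
      then show "AE x\<in>\<Omega> in lborel. ?u x = 0"
        by (rule AE_mp) (auto intro!: AE_I2)
    next
      assume ae: "AE x\<in>\<Omega> in lborel. ?u x = 0"
      have "(LINT x:\<Omega>|lborel. \<phi> i x * ?u x) = 0" if "i < n" for i
        unfolding set_lebesgue_integral_def
        by (rule integral_eq_zero_AE, rule AE_mp[OF ae]) (auto intro!: AE_I2)
      then show "mass_matrix \<Omega> n \<phi> *\<^sub>v v = 0\<^sub>v n"
        using mass_matrix_mult_vec[where \<phi>=\<phi>, OF v int] carr by (intro eq_vecI) auto
    }
  qed
  then show ?thesis using mat_kernel[OF carr] by auto
qed


section \<open>Geometry of mesh cells\<close>

lemma finite_bounded_multiindices: "finite {\<alpha>::'d::finite \<Rightarrow> nat. \<forall>i. \<alpha> i \<le> k}"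
  using finite_PiE[of "UNIV :: 'd set" "\<lambda>_. {..k}"] by (simp add: PiE_def Pi_def)

lemma const_in_polys:
  assumes "finite A" "(\<lambda>_. 0) \<in> A"
  shows "(\<lambda>_. c) \<in> polys A"
proof -
  have "(\<lambda>x. \<Sum>\<alpha>\<in>A. (if \<alpha> = (\<lambda>_. 0) then c else 0) * (\<Prod>i\<in>UNIV. (x $ i) ^ \<alpha> i)) = (\<lambda>_. c)"
  proof
    fix x :: "real^'a"
    have "(\<Sum>\<alpha>\<in>A. (if \<alpha> = (\<lambda>_. 0) then c else 0) * (\<Prod>i\<in>UNIV. (x $ i) ^ \<alpha> i)) =
        (\<Sum>\<alpha>\<in>A. if \<alpha> = (\<lambda>_. 0) then c else 0)"
      by (rule sum.cong) auto
    also have "\<dots> = c" using assms by simp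
    finally show "(\<Sum>\<alpha>\<in>A. (if \<alpha> = (\<lambda>_. 0) then c else 0) * (\<Prod>i\<in>UNIV. (x $ i) ^ \<alpha> i)) = c" .
  qed
  then show ?thesis unfolding polys_def
    by (auto intro!: exI[of _ "\<lambda>\<alpha>. if \<alpha> = (\<lambda>_. 0) then c else 0"])
qed

lemma const_in_ref_polys: "(\<lambda>_. c) \<in> (ref_polys t k :: (real^'d \<Rightarrow> real) set)"
proof (cases t)
  case Simplicial
  have "\<alpha> i \<le> k" if "(\<Sum>i\<in>UNIV. \<alpha> i) \<le> k" for \<alpha> :: "'d \<Rightarrow> nat" and i
    using member_le_sum[of i UNIV \<alpha>] that by simp
  then have "{\<alpha>::'d \<Rightarrow> nat. (\<Sum>i\<in>UNIV. \<alpha> i) \<le> k} \<subseteq> {\<alpha>. \<forall>i. \<alpha> i \<le> k}"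
    by blast
  then have "finite {\<alpha>::'d \<Rightarrow> nat. (\<Sum>i\<in>UNIV. \<alpha> i) \<le> k}"
    by (rule finite_subset) (rule finite_bounded_multiindices)
  then have "(\<lambda>_. c) \<in> (P_polys k :: (real^'d \<Rightarrow> real) set)" unfolding P_polys_def by (rule const_in_polys) simp
  with Simplicial show ?thesis by simp
next
  case Tensor
  have "(\<lambda>_. c) \<in> (Q_polys k :: (real^'d \<Rightarrow> real) set)"
    unfolding Q_polys_def by (rule const_in_polys[OF finite_bounded_multiindices]) simp
  with Tensor show ?thesis by simp
qed

lemma differentiable_prod:
  fixes f :: "'i \<Rightarrow> 'a::real_normed_vector \<Rightarrow> real"
  assumes "\<And>i. i \<in> I \<Longrightarrow> f i differentiable (at x within S)"
  shows "(\<lambda>x. \<Prod>i\<in>I. f i x) differentiable (at x within S)"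
  using assms by (induction I rule: infinite_finite_induct) (auto intro!: differentiable_mult)

lemma differentiable_polys:
  assumes "p \<in> polys A"
  shows "p differentiable (at x within S)"
proof -
  have coord: "(\<lambda>x::real^'a. x $ i) differentiable (at x within S)" for i
    by (rule bounded_linear_imp_differentiable[OF bounded_linear_vec_nth])
  obtain c where p: "p = (\<lambda>x. \<Sum>\<alpha>\<in>A. c \<alpha> * (\<Prod>i\<in>UNIV. (x $ i) ^ \<alpha> i))"
    using assms by (auto simp: polys_def)
  show ?thesis
  proof (cases "finite A")
    case True
    then show ?thesis unfolding p
      by (intro differentiable_sum ballI differentiable_mult differentiable_prod
          differentiable_power coord differentiable_const)
  qed (simp add: p)
qed

lemma element_map_differentiable_on:
  assumes "element_map t F"
  shows "F differentiable_on S"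
proof -
  have "(\<lambda>x. F x $ i) differentiable (at x within S)" for i x
  proof -
    have "(\<lambda>x. F x $ i) \<in> ref_polys t 1" using assms by (simp add: element_map_def)
    then show ?thesis
      by (cases t) (auto simp: P_polys_def Q_polys_def intro: differentiable_polys)
  qed
  then show ?thesis unfolding differentiable_on_def
    by (subst differentiable_componentwise_within) (auto simp: Basis_vec_def inner_axis)
qed

lemma convex_ref_cell: "convex (ref_cell t)"
  by (cases t) (auto intro: convex_convex_hull)

lemma compact_ref_cell: "compact (ref_cell t)"
  by (cases t) (auto intro: finite_imp_compact_convex_hull)

lemma interior_ref_cell_nonempty: "interior (ref_cell t :: (real^'d) set) \<noteq> {}"
proof (cases t)
  case Simplicial
  then show ?thesis
    using interior_std_simplex_nonempty[where 'a="real^'d"] by auto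
next
  case Tensor
  have "(\<chi> i. 1/2) \<in> box 0 (1 :: real^'d)" by (simp add: mem_box_cart)
  then show ?thesis using Tensor by (auto simp: interior_cbox)
qed

lemma compact_cell:
  assumes "element_map t F"
  shows "compact (cell t F)"
  unfolding cell_def
  by (intro compact_continuous_image compact_ref_cell differentiable_imp_continuous_on
      element_map_differentiable_on[OF assms])

text \<open>Invariance of domain makes the image open, for affine and multilinear element maps alike.\<close>

lemma image_interior_ref_cell:
  assumes F: "element_map t F"
  shows "F ` interior (ref_cell t) \<subseteq> interior (cell t F)"
proof (rule interior_maximal)
  show "F ` interior (ref_cell t) \<subseteq> cell t F"
    unfolding cell_def using interior_subset by blast
  have "inj_on F (interior (ref_cell t))"
    using F interior_subset inj_on_subset unfolding element_map_def by blast
  then show "open (F ` interior (ref_cell t))"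
    by (intro invariance_of_domain differentiable_imp_continuous_on
        element_map_differentiable_on[OF F]) auto
qed

lemma interior_cell_nonempty:
  assumes "element_map t F"
  shows "interior (cell t F) \<noteq> {}"
  using image_interior_ref_cell[OF assms] interior_ref_cell_nonempty by blast

lemma negligible_image_frontier_ref_cell:
  assumes "element_map t F"
  shows "negligible (F ` frontier (ref_cell t))"
  by (rule negligible_differentiable_image_negligible[OF order_refl
        negligible_convex_frontier[OF convex_ref_cell] element_map_differentiable_on[OF assms]])

text \<open>Boundary points of a cell can only come from boundary points of the reference cell, because
  interior points have interior images.\<close>

lemma negligible_frontier_cell:
  assumes F: "element_map t F"
  shows "negligible (frontier (cell t F))"
proof (rule negligible_subset[OF negligible_image_frontier_ref_cell[OF F]])
  have "cell t F - interior (cell t F) \<subseteq> F ` (ref_cell t - interior (ref_cell t))"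
    using image_interior_ref_cell[OF F] unfolding cell_def by blast
  then show "frontier (cell t F) \<subseteq> F ` frontier (ref_cell t)"
    by (simp add: frontier_def compact_imp_closed compact_ref_cell compact_cell[OF F])
qed

lemma negligible_proper_cell_face:
  assumes F: "element_map t F" and "f \<in> proper_cell_faces t F"
  shows "negligible f"
proof -
  obtain g where g: "f = F ` g" "g face_of ref_cell t" "g \<noteq> ref_cell t"
    using assms(2) by (auto simp: proper_cell_faces_def)
  have "g \<subseteq> frontier (ref_cell t)"
    using face_of_disjoint_interior[OF g(2,3)] face_of_imp_subset[OF g(2)] closure_subset
    unfolding frontier_def by blast
  then show ?thesis
    using g(1) by (intro negligible_subset[OF negligible_image_frontier_ref_cell[OF F]]) auto
qed

text \<open>Two distinct cells meet in a proper face, which is a null set, whereas a nonempty open set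
  is not null.\<close>

lemma disjoint_interior_cells:
  assumes mesh: "is_mesh t \<Omega> \<T>" and FG: "F \<in> \<T>" "G \<in> \<T>" "F \<noteq> G"
  shows "interior (cell t F) \<inter> interior (cell t G) = {}"
proof -
  have "cell t F \<inter> cell t G \<in> proper_cell_faces t F" "element_map t F"
    using mesh FG unfolding is_mesh_def by auto
  then have "negligible (cell t F \<inter> cell t G)"
    by (rule negligible_proper_cell_face[rotated])
  then have "negligible (interior (cell t F) \<inter> interior (cell t G))"
    by (rule negligible_subset) (use interior_subset in blast)
  then show ?thesis
    using open_not_negligible[of "interior (cell t F) \<inter> interior (cell t G)"] by auto
qed

lemma negligible_mesh_skeleton:
  assumes "is_mesh t \<Omega> \<T>"
  shows "negligible (\<Union>F\<in>\<T>. frontier (cell t F))"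
  using assms by (auto simp: is_mesh_def intro!: negligible_Union negligible_frontier_cell)

lemma in_interior_cell:
  assumes mesh: "is_mesh t \<Omega> \<T>" and x: "x \<in> closure \<Omega>" "x \<notin> (\<Union>F\<in>\<T>. frontier (cell t F))"
  obtains F where "F \<in> \<T>" "x \<in> interior (cell t F)"
proof -
  obtain F where F: "F \<in> \<T>" "x \<in> cell t F"
    using mesh x(1) unfolding is_mesh_def by blast
  moreover have "x \<notin> frontier (cell t F)" using x(2) F(1) by blast
  ultimately show ?thesis using that closure_subset[of "cell t F"] by (auto simp: frontier_def)
qed


section \<open>The two pressure spaces\<close>

lemma open_subset_closure_diff_negligible:
  fixes U :: "'a::euclidean_space set"
  assumes "open U" "negligible N"
  shows "U \<subseteq> closure (U - N)"
proof (rule ccontr)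
  assume "\<not> U \<subseteq> closure (U - N)"
  then have "U - closure (U - N) \<noteq> {}" by blast
  moreover have "open (U - closure (U - N))" using assms(1) by (simp add: open_Diff)
  moreover have "U - closure (U - N) \<subseteq> N" using closure_subset[of "U - N"] by blast
  ultimately show False
    using open_not_negligible[of "U - closure (U - N)"] negligible_subset[OF assms(2)] by simp
qed

lemma nodal_basis_mem:
  assumes "nodal_basis V N n \<phi>" "i < n"
  shows "\<phi> i \<in> V"
proof -
  have delta: "\<phi> i = (\<lambda>x. \<Sum>j<n. (if j = i then 1 else 0) * \<phi> j x)"
  proof
    fix x
    have "(\<Sum>j<n. (if j = i then 1 else 0) * \<phi> j x) = (\<Sum>j<n. if j = i then \<phi> j x else 0)"
      by (rule sum.cong) auto
    also have "\<dots> = \<phi> i x" using assms(2) by simp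
    finally show "\<phi> i x = (\<Sum>j<n. (if j = i then 1 else 0) * \<phi> j x)" by (rule sym)
  qed
  have "\<phi> i \<in> fun_span n \<phi>"
    unfolding fun_span_def by (rule CollectI, rule exI, rule conjI[OF delta TrueI])
  moreover have "fun_span n \<phi> = V" using assms(1) unfolding nodal_basis_def by (rule conjunct1)
  ultimately show ?thesis by blast
qed

text \<open>Evaluation at the \<open>i\<close>-th node extracts the \<open>i\<close>-th coefficient. If the nodal values
  are all \<open>b\<close>, then so are the coefficients.\<close>

lemma nodal_basis_coefficients:
  assumes basis: "nodal_basis V N n \<phi>" and const: "\<And>x. x \<in> N \<Longrightarrow> (\<Sum>j<n. c j * \<phi> j x) = b"
    and i: "i < n"
  shows "c i = b"
proof -
  obtain a where a: "bij_betw a {..<n} N" "\<forall>i<n. \<forall>j<n. \<phi> i (a j) = (if i = j then 1 else 0)"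
    using basis unfolding nodal_basis_def by blast
  have "(\<Sum>j<n. c j * \<phi> j (a i)) = (\<Sum>j<n. if j = i then c j else 0)"
    using a(2) i by (intro sum.cong) auto
  also have "\<dots> = c i" using i by simp
  finally have "(\<Sum>j<n. c j * \<phi> j (a i)) = c i" .
  moreover have "a i \<in> N" using bij_betwE[OF a(1)] i by blast
  ultimately show ?thesis using const by metis
qed

lemma mesh_nodes_subset:
  assumes "is_mesh t \<Omega> \<T>"
  shows "mesh_nodes t \<T> k \<subseteq> closure \<Omega>"
proof -
  have "(\<Union>F\<in>\<T>. cell t F) = closure \<Omega>" using assms by (simp add: is_mesh_def)
  moreover have "ref_nodes t k \<subseteq> ref_cell t" by (auto simp: ref_nodes_def)
  ultimately show ?thesis by (fastforce simp: mesh_nodes_def cell_def)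
qed

lemma indicator_in_taylor_hood:
  assumes "is_mesh t \<Omega> \<T>"
  shows "indicator (closure \<Omega>) \<in> taylor_hood t \<Omega> \<T> k"
proof -
  have cells: "cell t F \<subseteq> closure \<Omega>" if "F \<in> \<T>" for F
    using assms that unfolding is_mesh_def by blast
  have "continuous_on (closure \<Omega>) (indicat_real (closure \<Omega>))"
    by (rule continuous_on_eq[OF continuous_on_const[of _ 1]]) auto
  moreover have "indicat_real (closure \<Omega>) \<in> local_space t k F" if "F \<in> \<T>" for F
    using cells[OF that] const_in_ref_polys[of 1 t k]
    by (cases t) (auto intro!: bexI[of _ "\<lambda>_. 1"] simp: cell_def image_subset_iff)
  ultimately show ?thesis by (simp add: taylor_hood_def)
qed

text \<open>The constant \<open>1\<close> is a Taylor--Hood function, and its nodal values are its coefficients.\<close>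

lemma taylor_hood_partition_of_unity:
  assumes mesh: "is_mesh t \<Omega> \<T>"
    and basis: "nodal_basis (taylor_hood t \<Omega> \<T> k) (mesh_nodes t \<T> k) n \<phi>"
    and x: "x \<in> closure \<Omega>"
  shows "(\<Sum>i<n. \<phi> i x) = 1"
proof -
  have "indicator (closure \<Omega>) \<in> fun_span n \<phi>"
  proof -
    have "fun_span n \<phi> = taylor_hood t \<Omega> \<T> k"
      using basis unfolding nodal_basis_def by (rule conjunct1)
    then show ?thesis using indicator_in_taylor_hood[OF mesh, of k] by simp
  qed
  then obtain c where c: "indicat_real (closure \<Omega>) = (\<lambda>x. \<Sum>i<n. c i * \<phi> i x)"
    unfolding fun_span_def by blast
  have one: "(\<Sum>j<n. c j * \<phi> j y) = 1" if "y \<in> closure \<Omega>" for y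
    using that by (simp flip: fun_cong[OF c, of y])
  have "c i = 1" if "i < n" for i
    by (rule nodal_basis_coefficients[OF basis one that])
      (rule subsetD[OF mesh_nodes_subset[OF mesh]])
  then have "(\<Sum>i<n. \<phi> i x) = (\<Sum>i<n. c i * \<phi> i x)" by simp
  also have "\<dots> = 1" by (rule one[OF x])
  finally show ?thesis .
qed

lemma element_indicator_sum:
  fixes d :: "nat \<Rightarrow> real"
  assumes mesh: "is_mesh t \<Omega> \<T>"
    and F: "bij_betw F {..<n} \<T>" "\<And>i. i < n \<Longrightarrow> \<psi> i = indicator (interior (cell t (F i)))"
    and j: "j < n" "x \<in> interior (cell t (F j))"
  shows "(\<Sum>i<n. d i * \<psi> i x) = d j"
proof -
  have "d i * \<psi> i x = (if i = j then d i else 0)" if i: "i < n" for i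
  proof (cases "i = j")
    case False
    have "F i \<noteq> F j"
      using inj_onD[OF bij_betw_imp_inj_on[OF F(1)], of i j] False i j(1) by blast
    moreover have "F i \<in> \<T>" "F j \<in> \<T>"
      using bij_betwE[OF F(1)] i j(1) by blast+
    ultimately have "x \<notin> interior (cell t (F i))"
      using disjoint_interior_cells[OF mesh, of "F i" "F j"] j(2) by blast
    then show ?thesis unfolding F(2)[OF i] using False by simp
  next
    case True
    then show ?thesis unfolding F(2)[OF i] using j(2) by simp
  qed
  then have "(\<Sum>i<n. d i * \<psi> i x) = (\<Sum>i<n. if i = j then d i else 0)"
    by (intro sum.cong) auto
  also have "\<dots> = d j" using j(1) by simp
  finally show ?thesis .
qed

text \<open>A continuous function that is elementwise constant up to a null set has a finite range, so it
  is constant on a connected domain.\<close>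

lemma continuous_ae_piecewise_constant_imp_constant:
  assumes \<Omega>: "open \<Omega>" "connected \<Omega>" and mesh: "is_mesh t \<Omega> \<T>"
    and q: "continuous_on (closure \<Omega>) q"
    and basis: "element_indicator_basis t \<T> n \<psi>"
    and ae: "AE x\<in>\<Omega> in lborel. q x + (\<Sum>j<n. d j * \<psi> j x) = 0"
  shows "\<exists>c. (\<forall>x\<in>closure \<Omega>. q x = c) \<and> (\<forall>j<n. d j = - c)"
proof -
  obtain F where F: "bij_betw F {..<n} \<T>" "\<And>i. i < n \<Longrightarrow> \<psi> i = indicator (interior (cell t (F i)))"
    using basis by (auto simp: element_indicator_basis_def)
  obtain N0 where N0: "N0 \<in> null_sets lborel"
      "{x. \<not> (x \<in> \<Omega> \<longrightarrow> q x + (\<Sum>j<n. d j * \<psi> j x) = 0)} \<subseteq> N0"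
    using ae by (auto simp: eventually_ae_filter)
  \<comment> \<open>Off \<open>N\<close> the equation holds pointwise, and each point is interior to some element.\<close>
  define N where "N = N0 \<union> (\<Union>G\<in>\<T>. frontier (cell t G))"
  have "negligible N0" using N0(1) by (simp add: negligible_iff_null_sets null_sets_completionI)
  then have N: "negligible N"
    unfolding N_def using negligible_mesh_skeleton[OF mesh] by (rule negligible_Un)
  have val: "q x = - d j" if "x \<in> \<Omega> - N" "j < n" "x \<in> interior (cell t (F j))" for x j
  proof -
    have "q x + (\<Sum>j<n. d j * \<psi> j x) = 0" using that(1) N0(2) by (auto simp: N_def)
    then show ?thesis using element_indicator_sum[where d=d, OF mesh F that(2,3)] by linarith
  qed
  have "q ` (\<Omega> - N) \<subseteq> (\<lambda>j. - d j) ` {..<n}"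
  proof
    fix y assume "y \<in> q ` (\<Omega> - N)"
    then obtain x where x: "x \<in> \<Omega> - N" "y = q x" by blast
    obtain G where G: "G \<in> \<T>" "x \<in> interior (cell t G)"
      using in_interior_cell[OF mesh, of x] x(1) closure_subset[of \<Omega>] by (auto simp: N_def)
    moreover obtain j where "j < n" "G = F j"
      using G(1) F(1) by (auto simp: bij_betw_def)
    ultimately show "y \<in> (\<lambda>j. - d j) ` {..<n}" using val x by blast
  qed
  moreover have cl: "closure (\<Omega> - N) = closure \<Omega>"
    using open_subset_closure_diff_negligible[OF \<Omega>(1) N]
    by (metis Diff_subset closure_closure closure_mono subset_antisym)
  ultimately have "q ` closure \<Omega> \<subseteq> (\<lambda>j. - d j) ` {..<n}"
    using image_closure_subset[of "\<Omega> - N" q "(\<lambda>j. - d j) ` {..<n}"] q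
    by (simp add: finite_imp_closed)
  then have "finite (q ` closure \<Omega>)" by (rule finite_subset) simp
  then have "q constant_on closure \<Omega>"
    by (rule continuous_finite_range_constant[OF connected_imp_connected_closure[OF \<Omega>(2)] q])
  then obtain c where c: "\<And>x. x \<in> closure \<Omega> \<Longrightarrow> q x = c" by (auto simp: constant_on_def)
  have "d j = - c" if j: "j < n" for j
  proof -
    have Fj: "F j \<in> \<T>" using F(1) j by (auto simp: bij_betw_def)
    have "interior (cell t (F j)) \<noteq> {}"
      using Fj mesh interior_cell_nonempty by (auto simp: is_mesh_def)
    moreover have "interior (cell t (F j)) \<subseteq> closure (\<Omega> - N)"
      unfolding cl using Fj mesh interior_subset unfolding is_mesh_def by blast
    ultimately have "interior (cell t (F j)) \<inter> (\<Omega> - N) \<noteq> {}"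
      using open_Int_closure_eq_empty[of "interior (cell t (F j))" "\<Omega> - N"] by auto
    then obtain x where x: "x \<in> interior (cell t (F j))" "x \<in> \<Omega> - N" by blast
    then have "q x = c" using c closure_subset[of \<Omega>] by blast
    then show ?thesis using val[OF x(2) j x(1)] by simp
  qed
  with c show ?thesis by blast
qed

lemma set_integrable_mult_bounded:
  fixes f g :: "'a::euclidean_space \<Rightarrow> real"
  assumes "open \<Omega>" "bounded \<Omega>" "f \<in> borel_measurable borel" "g \<in> borel_measurable borel"
    and "bounded (range f)" "bounded (range g)"
  shows "set_integrable lborel \<Omega> (\<lambda>x. f x * g x)"
proof -
  obtain A B where AB: "\<And>x. norm (f x) \<le> A" "\<And>x. norm (g x) \<le> B"
    using assms(5,6) by (auto simp: bounded_iff)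
  show ?thesis unfolding set_integrable_def
  proof (rule integrableI_bounded_set_indicator[where B="A * B"])
    show "emeasure lborel \<Omega> < \<infinity>" using assms(2) by (rule emeasure_bounded_finite)
    have "norm (f x * g x) \<le> A * B" for x
      unfolding norm_mult
      by (intro mult_mono AB norm_ge_zero order_trans[OF norm_ge_zero AB(1)])
    then show "AE x in lborel. x \<in> \<Omega> \<longrightarrow> norm (f x * g x) \<le> A * B" by simp
  qed (use assms in auto)
qed

lemma taylor_hood_measurable_bounded:
  assumes "bounded \<Omega>" "q \<in> taylor_hood t \<Omega> \<T> k"
  shows "q \<in> borel_measurable borel" "bounded (range q)"
proof -
  have q: "continuous_on (closure \<Omega>) q" "\<And>x. x \<notin> closure \<Omega> \<Longrightarrow> q x = 0"
    using assms(2) by (auto simp: taylor_hood_def)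
  have "(\<lambda>x. indicator (closure \<Omega>) x *\<^sub>R q x) \<in> borel_measurable borel"
    by (rule borel_measurable_continuous_on_indicator[OF _ q(1)]) simp
  also have "(\<lambda>x. indicator (closure \<Omega>) x *\<^sub>R q x) = q"
    using q(2) by (fastforce simp: indicator_def)
  finally show "q \<in> borel_measurable borel" .
  have "compact (q ` closure \<Omega>)"
    using assms(1) q(1) by (intro compact_continuous_image) auto
  then have "bounded (insert 0 (q ` closure \<Omega>))" by (simp add: compact_imp_bounded)
  then show "bounded (range q)" by (rule bounded_subset) (use q(2) in auto)
qed


section \<open>The nullspace of the pressure mass matrix\<close>

theorem proposition1:
  fixes \<Omega> :: "(real^'d) set"
    and \<M> :: "(real^'d \<Rightarrow> real^'d) set set"
    and \<T> :: "(real^'d \<Rightarrow> real^'d) set"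
    and t :: cell_type
    and k n\<^sub>k n\<^sub>p n\<^sub>0 :: nat
    and \<phi> :: "nat \<Rightarrow> real^'d \<Rightarrow> real"
  assumes dim: "CARD('d) \<in> {2, 3}"
    and domain: "polyhedral_domain \<Omega>"
    and mesh: "shape_regular_family t \<Omega> \<M>" "\<T> \<in> \<M>"
    and degree: "k \<ge> 1" "t = Simplicial \<Longrightarrow> k \<ge> CARD('d) - 1"
    and sizes: "n\<^sub>k \<le> n\<^sub>p" "n\<^sub>0 = n\<^sub>p - n\<^sub>k"
    and frame: "enriched_taylor_hood t \<Omega> \<T> k = fun_span n\<^sub>p \<phi>"
    and lagrange_TH: "nodal_basis (taylor_hood t \<Omega> \<T> k) (mesh_nodes t \<T> k) n\<^sub>k \<phi>"
    and lagrange_0: "element_indicator_basis t \<T> n\<^sub>0 (\<lambda>i. \<phi> (n\<^sub>k + i))"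
  shows "mat_kernel (mass_matrix \<Omega> n\<^sub>p \<phi>) = vec_span n\<^sub>p {ones_vec n\<^sub>k @\<^sub>v - ones_vec n\<^sub>0}"
proof -
  let ?k = "ones_vec n\<^sub>k @\<^sub>v - ones_vec n\<^sub>0"
  have \<Omega>: "open \<Omega>" "connected \<Omega>" "bounded \<Omega>" using domain by (auto simp: polyhedral_domain_def)
  have is_mesh: "is_mesh t \<Omega> \<T>" using mesh by (auto simp: shape_regular_family_def)
  have np: "n\<^sub>p = n\<^sub>k + n\<^sub>0" using sizes by simp
  obtain F where F: "bij_betw F {..<n\<^sub>0} \<T>"
      "\<And>i. i < n\<^sub>0 \<Longrightarrow> \<phi> (n\<^sub>k + i) = indicator (interior (cell t (F i)))"
    using lagrange_0 by (auto simp: element_indicator_basis_def)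

  have reg: "\<phi> i \<in> borel_measurable borel \<and> bounded (range (\<phi> i))" if "i < n\<^sub>p" for i
  proof (cases "i < n\<^sub>k")
    case True
    then show ?thesis
      using taylor_hood_measurable_bounded[OF \<Omega>(3)] nodal_basis_mem[OF lagrange_TH] by blast
  next
    case False
    then have "\<phi> i = indicator (interior (cell t (F (i - n\<^sub>k))))"
      using F(2)[of "i - n\<^sub>k"] that np by simp
    moreover have "bounded (range (indicat_real S))" for S :: "(real^'d) set"
      by (rule finite_imp_bounded, rule finite_subset[of _ "{0,1}"]) (auto simp: indicator_def)
    ultimately show ?thesis by simp
  qed
  have split_sum: "(\<Sum>i<n\<^sub>p. a i * \<phi> i x) =
      (\<Sum>i<n\<^sub>k. a i * \<phi> i x) + (\<Sum>j<n\<^sub>0. a (n\<^sub>k + j) * \<phi> (n\<^sub>k + j) x)" for a x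
    unfolding np by (induction n\<^sub>0) (auto simp: add.assoc)

  have "mat_kernel (mass_matrix \<Omega> n\<^sub>p \<phi>) =
      {v \<in> carrier_vec n\<^sub>p. AE x\<in>\<Omega> in lborel. (\<Sum>i<n\<^sub>p. vec_index v i * \<phi> i x) = 0}"
    by (rule mat_kernel_mass_matrix) (use reg set_integrable_mult_bounded[OF \<Omega>(1,3)] in blast)
  also have "\<dots> = {c \<cdot>\<^sub>v ?k | c. True}"
  proof (intro Set.set_eqI iffI)
    fix v assume "v \<in> {v \<in> carrier_vec n\<^sub>p. AE x\<in>\<Omega> in lborel. (\<Sum>i<n\<^sub>p. vec_index v i * \<phi> i x) = 0}"
    then have v: "v \<in> carrier_vec n\<^sub>p"
      and ae: "AE x\<in>\<Omega> in lborel. (\<Sum>i<n\<^sub>k. vec_index v i * \<phi> i x) +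
        (\<Sum>j<n\<^sub>0. vec_index v (n\<^sub>k + j) * \<phi> (n\<^sub>k + j) x) = 0"
      by (auto simp: split_sum)
    \<comment> \<open>The Taylor--Hood part is a constant \<open>c\<close>, which determines all coefficients.\<close>
    have cont: "continuous_on (closure \<Omega>) (\<lambda>x. \<Sum>i<n\<^sub>k. vec_index v i * \<phi> i x)"
      using nodal_basis_mem[OF lagrange_TH]
      by (intro continuous_on_sum continuous_on_mult_left) (auto simp: taylor_hood_def)
    have "\<exists>c. (\<forall>x\<in>closure \<Omega>. (\<Sum>i<n\<^sub>k. vec_index v i * \<phi> i x) = c) \<and>
        (\<forall>j<n\<^sub>0. vec_index v (n\<^sub>k + j) = - c)"
      by (rule continuous_ae_piecewise_constant_imp_constant
          [OF \<Omega>(1,2) is_mesh cont lagrange_0, where d="\<lambda>j. vec_index v (n\<^sub>k + j)", OF ae])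
    then obtain c where c: "\<And>x. x \<in> closure \<Omega> \<Longrightarrow> (\<Sum>i<n\<^sub>k. vec_index v i * \<phi> i x) = c"
        "\<And>j. j < n\<^sub>0 \<Longrightarrow> vec_index v (n\<^sub>k + j) = - c"
      by blast
    have "vec_index v i = c" if "i < n\<^sub>k" for i
      by (rule nodal_basis_coefficients[OF lagrange_TH c(1) that])
        (rule subsetD[OF mesh_nodes_subset[OF is_mesh]])
    moreover have "vec_index v i = - c" if "\<not> i < n\<^sub>k" "i < n\<^sub>k + n\<^sub>0" for i
      using c(2)[of "i - n\<^sub>k"] that by simp
    ultimately have "v = c \<cdot>\<^sub>v ?k"
      using v np by (intro eq_vecI) (auto simp: ones_vec_def)
    then show "v \<in> {c \<cdot>\<^sub>v ?k | c. True}" by blast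
  next
    fix v assume "v \<in> {c \<cdot>\<^sub>v ?k | c. True}"
    then obtain c where v: "v = c \<cdot>\<^sub>v ?k" by blast
    have off_skeleton: "AE x in lborel. x \<notin> (\<Union>G\<in>\<T>. frontier (cell t G))"
    proof (rule AE_not_in)
      have "closed (\<Union>G\<in>\<T>. frontier (cell t G))"
        using is_mesh by (auto simp: is_mesh_def)
      then show "(\<Union>G\<in>\<T>. frontier (cell t G)) \<in> null_sets lborel"
        using negligible_mesh_skeleton[OF is_mesh]
        by (simp add: negligible_iff_null_sets null_sets_completion_iff borel_closed)
    qed
    have vanish: "(\<Sum>i<n\<^sub>p. vec_index v i * \<phi> i x) = 0"
      if x: "x \<in> \<Omega>" "x \<notin> (\<Union>G\<in>\<T>. frontier (cell t G))" for x
    proof -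
      have xc: "x \<in> closure \<Omega>" using x(1) closure_subset by blast
      obtain G where G: "G \<in> \<T>" "x \<in> interior (cell t G)"
        using in_interior_cell[OF is_mesh xc x(2)] .
      obtain j where j: "j < n\<^sub>0" "G = F j" using G(1) F(1) by (auto simp: bij_betw_def)
      have "(\<Sum>i<n\<^sub>k. vec_index v i * \<phi> i x) = c * (\<Sum>i<n\<^sub>k. \<phi> i x)"
        unfolding sum_distrib_left v by (intro sum.cong) (auto simp: ones_vec_def)
      moreover have "(\<Sum>j<n\<^sub>0. vec_index v (n\<^sub>k + j) * \<phi> (n\<^sub>k + j) x) = (\<Sum>j<n\<^sub>0. - c * \<phi> (n\<^sub>k + j) x)"
        unfolding v by (intro sum.cong) (auto simp: ones_vec_def)
      moreover have "(\<Sum>j<n\<^sub>0. - c * \<phi> (n\<^sub>k + j) x) = - c"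
        using element_indicator_sum[OF is_mesh F j(1), where d="\<lambda>_. - c"] G(2) j(2) by simp
      ultimately show ?thesis
        using taylor_hood_partition_of_unity[OF is_mesh lagrange_TH xc] by (simp add: split_sum)
    qed
    have "AE x\<in>\<Omega> in lborel. (\<Sum>i<n\<^sub>p. vec_index v i * \<phi> i x) = 0"
      using off_skeleton by (rule eventually_mono) (use vanish in blast)
    moreover have "v \<in> carrier_vec n\<^sub>p" by (simp add: v np ones_vec_def)
    ultimately show "v \<in> {v \<in> carrier_vec n\<^sub>p. AE x\<in>\<Omega> in lborel. (\<Sum>i<n\<^sub>p. vec_index v i * \<phi> i x) = 0}"
      by simp
  qed
  also have "\<dots> = vec_span n\<^sub>p {?k}"
    by (rule vec_span_singleton[symmetric]) (simp add: np ones_vec_def)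
  finally show ?thesis .
qed

end
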